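(* Let $s\in(0,1]$, let $\Phi_s:[0,\infty)\to[0,\infty)$ be an $s$-Young function, and let $\phi\in G_\phi$. Then $\left(\ell_{\phi,\Phi_s},\lVert\cdot\rVert_{\ell_{\phi,\Phi_s}}\right)$ is a quasi-Banach space.
   Context: Let $s\in(0,1]$. A function $\Phi_s:[0,\infty)\to\mathbb{R}$ is $s$-convex if $\Phi_s(ax+by)\le a^s\Phi_s(x)+b^s\Phi_s(y)$ for all $x,y\in[0,\infty)$ and all $a,b\in[0,\infty)$ with $a^s+b^s=1$. A function $\Phi_s:[0,\infty)\to[0,\infty)$ is an $s$-Young function if it is $s$-convex, continuous, $\Phi_s(0)=0$, and $\lim_{t\to\infty}\Phi_s(t)=\infty$. Let $\mathbb{N}_0=\mathbb{N}\cup\{0\}$. For $m\in\mathbb{Z}$ and $N\in\mathbb{N}_0$ put $S_{m,N}=\{m-N,\dots,m,\dots,m+N\}$, so $|S_{m,N}|=2N+1$. $G_\phi$ is the set of all functions $\phi:2\mathbb{N}_0+1\to(0,\infty)$ (defined on the odd positive integers) that are nondecreasing and such that $\frac{\phi(2N+1)}{2N+1}$ is nonincreasing in $N$. For a real sequence $x=(x_k)_{k\in\mathbb{Z}}$ define $$\lVert x\rVert_{\phi,\Phi_s,m,N}=\inf\Big\{b>0 \;\Big|\; \frac{\phi(2N+1)}{|S_{m,N}|}\sum_{k\in S_{m,N}}\Phi_s\Big(\frac{|x_k|}{b}\Big)\le 1\Big\},\qquad \lVert x\rVert_{\ell_{\phi,\Phi_s}}=\sup_{m\in\mathbb{Z},\,N\in\mathbb{N}_0}\lVert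 x\rVert_{\phi,\Phi_s,m,N}.$$ The generalized discrete Orlicz-Morrey space $\ell_{\phi,\Phi_s}$ is the set of all real sequences $x=(x_k)_{k\in\mathbb{Z}}$ with $\lVert x\rVert_{\ell_{\phi,\Phi_s}}<\infty$, with termwise operations. A function $\lVert\cdot\rVert:X\to[0,\infty)$ on a real vector space $X$ is a quasi-norm if for all $x,y\in X$ and $a\in\mathbb{R}$: (a) $\lVert x\rVert\ge 0$; (b) $\lVert x\rVert=0$ if and only if $x=0$; (c) $\lVert ax\rVert=|a|\lVert x\rVert$; and (d) there is a constant $C\ge 1$ (independent of $x,y$) such that $\lVert x+y\rVert\le C(\lVert x\rVert+\lVert y\rVert)$ for all $x,y\in X$. A quasi-Banach space is a real vector space with a quasi-norm that is complete: every sequence $(x_n)$ that is Cauchy (for every $\varepsilon>0$, $\lVert x_n-x_m\rVert<\varepsilon$ for all sufficiently large $n,m$) converges to some $x\in X$, i.e. $\lVert x_n-x\rVert\to 0$. *)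

theory Defs
  imports Complex_Main "HOL-Library.Extended_Real" "HOL-Library.Function_Algebras"
begin

text \<open>Functions on \<open>[0,\<infinity>)\<close> are total functions on \<open>real\<close> of which only the
  values on \<open>{0..}\<close> are constrained. Since \<open>s > 0\<close> throughout, \<open>0 powr s = 0\<close> is
  the correct value of \<open>0\<^sup>s\<close>.\<close>

definition s_convex :: "real \<Rightarrow> (real \<Rightarrow> real) \<Rightarrow> bool" where
  "s_convex s \<Phi> \<longleftrightarrow>
     (\<forall>x\<ge>0. \<forall>y\<ge>0. \<forall>a\<ge>0. \<forall>b\<ge>0. a powr s + b powr s = 1 \<longrightarrow>
        \<Phi> (a * x + b * y) \<le> a powr s * \<Phi> x + b powr s * \<Phi> y)"

definition s_young :: "real \<Rightarrow> (real \<Rightarrow> real) \<Rightarrow> bool" where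
  "s_young s \<Phi> \<longleftrightarrow>
     (\<forall>t\<ge>0. \<Phi> t \<ge> 0) \<and> s_convex s \<Phi> \<and> continuous_on {0..} \<Phi> \<and> \<Phi> 0 = 0 \<and>
     filterlim \<Phi> at_top at_top"

text \<open>Only the values of \<open>\<phi>\<close> at odd arguments are constrained.\<close>

definition G_phi :: "(nat \<Rightarrow> real) set" where
  "G_phi = {\<phi>. (\<forall>n. odd n \<longrightarrow> \<phi> n > 0) \<and>
     (\<forall>m n. odd m \<longrightarrow> odd n \<longrightarrow> m \<le> n \<longrightarrow> \<phi> m \<le> \<phi> n) \<and>
     antimono (\<lambda>N. \<phi> (2 * N + 1) / real (2 * N + 1))}"

definition window :: "int \<Rightarrow> nat \<Rightarrow> int set" where
  "window m N = {m - int N..m + int N}"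

text \<open>The norms are extended reals, so that the supremum is \<open>\<infinity>\<close> (rather than an
  unspecified real) on sequences outside the space.\<close>

definition local_norm ::
  "(nat \<Rightarrow> real) \<Rightarrow> (real \<Rightarrow> real) \<Rightarrow> int \<Rightarrow> nat \<Rightarrow> (int \<Rightarrow> real) \<Rightarrow> ereal" where
  "local_norm \<phi> \<Phi> m N x =
     Inf (ereal ` {b. b > 0 \<and>
       \<phi> (2 * N + 1) / real (card (window m N)) * (\<Sum>k\<in>window m N. \<Phi> (\<bar>x k\<bar> / b)) \<le> 1})"

definition orlicz_morrey_norm ::
  "(nat \<Rightarrow> real) \<Rightarrow> (real \<Rightarrow> real) \<Rightarrow> (int \<Rightarrow> real) \<Rightarrow> ereal" where
  "orlicz_morrey_norm \<phi> \<Phi> x = (SUP (m, N)\<in>UNIV. local_norm \<phi> \<Phi> m N x)"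

definition orlicz_morrey_space ::
  "(nat \<Rightarrow> real) \<Rightarrow> (real \<Rightarrow> real) \<Rightarrow> (int \<Rightarrow> real) set" where
  "orlicz_morrey_space \<phi> \<Phi> = {x. orlicz_morrey_norm \<phi> \<Phi> x < \<infinity>}"

text \<open>The real vector space is a linear subspace \<open>X\<close> of an ambient space with scalar
  multiplication \<open>scale\<close>; there is no \<^class>\<open>real_vector\<close> instance for function types.\<close>

locale quasi_normed_space = vector_space scale
  for scale :: "real \<Rightarrow> 'a::ab_group_add \<Rightarrow> 'a" +
  fixes X :: "'a set" and qnorm :: "'a \<Rightarrow> real"
  assumes subspace_carrier: "module.subspace scale X"
    and qnorm_nonneg: "x \<in> X \<Longrightarrow> qnorm x \<ge> 0"
    and qnorm_eq_0_iff: "x \<in> X \<Longrightarrow> qnorm x = 0 \<longleftrightarrow> x = 0"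
    and qnorm_scale: "x \<in> X \<Longrightarrow> qnorm (scale a x) = \<bar>a\<bar> * qnorm x"
    and qnorm_quasi_triangle:
      "\<exists>C\<ge>1. \<forall>x\<in>X. \<forall>y\<in>X. qnorm (x + y) \<le> C * (qnorm x + qnorm y)"

locale quasi_banach_space = quasi_normed_space +
  assumes qnorm_complete:
    "(\<And>n. u n \<in> X) \<Longrightarrow>
     (\<And>e. e > 0 \<Longrightarrow> \<exists>M. \<forall>n\<ge>M. \<forall>m\<ge>M. qnorm (u n - u m) < e) \<Longrightarrow>
     \<exists>x\<in>X. (\<lambda>n::nat. qnorm (u n - x)) \<longlonglongrightarrow> 0"

end

theory Submission
  imports Defs
begin

text \<open>Call \<open>b > 0\<close> admissible for \<open>x\<close> if it satisfies the modular inequality on every window; the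
  norm is then the infimum of the admissible numbers, because \<open>\<Phi>\<close> is nondecreasing and so
  admissibility is inherited by larger numbers. Applying \<open>s\<close>-convexity with both weights
  \<open>2\<^bsup>-1/s\<^esup>\<close> makes \<open>2\<^bsup>1/s\<^esup> (b + c)\<close> admissible for \<open>x + y\<close>, which gives the quasi-triangle
  inequality. The windows with one point bound every coordinate by the norm, so a Cauchy sequence
  has a coordinatewise limit; since the modular inequality involves only finite sums and \<open>\<Phi>\<close> is
  continuous, it survives this limit and gives convergence in norm.\<close>

locale orlicz_morrey =
  fixes s :: real and \<Phi> :: "real \<Rightarrow> real" and \<phi> :: "nat \<Rightarrow> real"
  assumes s_pos: "0 < s"
    and young: "s_young s \<Phi>"
    and weight: "\<phi> \<in> G_phi"
begin

definition modular :: "int \<Rightarrow> nat \<Rightarrow> real \<Rightarrow> (int \<Rightarrow> real) \<Rightarrow> real" where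
  "modular m N b x =
     \<phi> (2 * N + 1) / real (card (window m N)) * (\<Sum>k\<in>window m N. \<Phi> (\<bar>x k\<bar> / b))"

definition admissible :: "real \<Rightarrow> (int \<Rightarrow> real) \<Rightarrow> bool" where
  "admissible b x \<longleftrightarrow> b > 0 \<and> (\<forall>m N. modular m N b x \<le> 1)"

abbreviation qnorm :: "(int \<Rightarrow> real) \<Rightarrow> real" where
  "qnorm x \<equiv> real_of_ereal (orlicz_morrey_norm \<phi> \<Phi> x)"

abbreviation space :: "(int \<Rightarrow> real) set" where
  "space \<equiv> orlicz_morrey_space \<phi> \<Phi>"

section \<open>Sign, monotonicity and continuity of \<Phi>; positivity of the weight\<close>

lemma Phi_nonneg: "0 \<le> t \<Longrightarrow> 0 \<le> \<Phi> t"
  and Phi_0: "\<Phi> 0 = 0"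
  and Phi_continuous: "continuous_on {0..} \<Phi>"
  and Phi_at_top: "filterlim \<Phi> at_top at_top"
  using young by (auto simp: s_young_def)

lemma Phi_s_convex:
  "\<lbrakk>0 \<le> x; 0 \<le> y; 0 \<le> a; 0 \<le> b; a powr s + b powr s = 1\<rbrakk>
     \<Longrightarrow> \<Phi> (a * x + b * y) \<le> a powr s * \<Phi> x + b powr s * \<Phi> y"
  using young by (auto simp: s_young_def s_convex_def)

lemma phi_pos: "0 < \<phi> (2 * N + 1)"
  using weight by (auto simp: G_phi_def)

lemma card_window_pos: "0 < card (window m N)"
  by (simp add: window_def)

lemma factor_pos: "0 < \<phi> (2 * N + 1) / real (card (window m N))"
  using phi_pos card_window_pos by simp

text \<open>Since \<Phi> vanishes at 0, \<open>s\<close>-convexity between \<open>y\<close> and 0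
  suffices: \<open>x = a * y + b * 0\<close> with \<open>a = x / y\<close>, and \<open>b\<close> is
  chosen only to make the \<open>s\<close>-th powers of the weights add up to 1.\<close>

lemma Phi_mono:
  assumes "0 \<le> x" "x \<le> y"
  shows "\<Phi> x \<le> \<Phi> y"
proof (cases "y = 0")
  case False
  then have y: "y > 0" using assms by simp
  define a where "a = x / y"
  define b where "b = (1 - a powr s) powr (1 / s)"
  have a: "0 \<le> a" "a \<le> 1" using assms y by (auto simp: a_def)
  then have as: "a powr s \<le> 1" using s_pos by (simp add: powr_le1)
  have "a powr s + b powr s = 1"
    using as s_pos by (simp add: b_def powr_powr)
  then have "\<Phi> (a * y + b * 0) \<le> a powr s * \<Phi> y + b powr s * \<Phi> 0"
    using a y by (intro Phi_s_convex) (auto simp: b_def)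
  also have "\<dots> \<le> \<Phi> y"
    using as Phi_nonneg[of y] y by (simp add: Phi_0 mult_left_le_one_le)
  finally show ?thesis using y by (simp add: a_def)
qed (use assms in simp)

section \<open>The modular under monotone change, scaling and addition\<close>

lemma modular_mono:
  assumes "0 < b" "0 < c" "\<And>k. \<bar>x k\<bar> / b \<le> \<bar>y k\<bar> / c"
  shows "modular m N b x \<le> modular m N c y"
  unfolding modular_def
  using assms factor_pos[of N m]
  by (intro mult_left_mono sum_mono Phi_mono) auto

lemma modular_antimono:
  "\<lbrakk>0 < b; b \<le> c\<rbrakk> \<Longrightarrow> modular m N c x \<le> modular m N b x"
  by (intro modular_mono) (auto intro: divide_left_mono)

lemma modular_scale:
  "a \<noteq> 0 \<Longrightarrow> modular m N (\<bar>a\<bar> * b) (\<lambda>k. a * x k) = modular m N b x"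
  by (simp add: modular_def abs_mult)

lemma admissible_scale:
  "\<lbrakk>a \<noteq> 0; admissible b x\<rbrakk> \<Longrightarrow> admissible (\<bar>a\<bar> * b) (\<lambda>k. a * x k)"
  by (simp add: admissible_def modular_scale)

lemma admissible_0: "0 < b \<Longrightarrow> admissible b 0"
  by (simp add: admissible_def modular_def Phi_0)

text \<open>Each weight \<open>1 / r\<close> with \<open>r = 2 powr (1 / s)\<close> has
  \<open>s\<close>-th power \<open>1 / 2\<close>, so \<open>s\<close>-convexity turns the sum into
  an average of modulars, termwise in \<open>k\<close>.\<close>

lemma modular_add:
  assumes "0 < c"
  shows "modular m N (2 powr (1 / s) * c) (x + y) \<le> (modular m N c x + modular m N c y) / 2"
proof -
  define r :: real where "r = 2 powr (1 / s)"
  have r: "0 < r" by (simp add: r_def)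
  have rs: "(1 / r) powr s = 1 / 2"
    using s_pos by (simp add: r_def powr_divide powr_powr)
  have "\<Phi> (\<bar>x k + y k\<bar> / (r * c)) \<le> (\<Phi> (\<bar>x k\<bar> / c) + \<Phi> (\<bar>y k\<bar> / c)) / 2" for k
  proof -
    have "\<Phi> (\<bar>x k + y k\<bar> / (r * c)) \<le> \<Phi> (1 / r * (\<bar>x k\<bar> / c) + 1 / r * (\<bar>y k\<bar> / c))"
      using r assms abs_triangle_ineq[of "x k" "y k"]
      by (intro Phi_mono) (auto simp: field_simps)
    also have "\<dots> \<le> (1 / r) powr s * \<Phi> (\<bar>x k\<bar> / c) + (1 / r) powr s * \<Phi> (\<bar>y k\<bar> / c)"
      using r assms rs by (intro Phi_s_convex) auto
    finally show ?thesis by (simp add: rs)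
  qed
  then have "(\<Sum>k\<in>window m N. \<Phi> (\<bar>(x + y) k\<bar> / (r * c)))
      \<le> (\<Sum>k\<in>window m N. (\<Phi> (\<bar>x k\<bar> / c) + \<Phi> (\<bar>y k\<bar> / c)) / 2)"
    by (intro sum_mono) simp
  also have "\<dots> = ((\<Sum>k\<in>window m N. \<Phi> (\<bar>x k\<bar> / c)) + (\<Sum>k\<in>window m N. \<Phi> (\<bar>y k\<bar> / c))) / 2"
    by (simp add: sum.distrib flip: sum_divide_distrib)
  finally have "modular m N (r * c) (x + y) \<le> \<phi> (2 * N + 1) / real (card (window m N)) *
      (((\<Sum>k\<in>window m N. \<Phi> (\<bar>x k\<bar> / c)) + (\<Sum>k\<in>window m N. \<Phi> (\<bar>y k\<bar> / c))) / 2)"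
    unfolding modular_def using factor_pos[of N m] by (intro mult_left_mono) auto
  then show ?thesis
    by (simp only: modular_def r_def times_divide_eq_right distrib_left)
qed

lemma admissible_add:
  assumes "admissible b x" "admissible c y"
  shows "admissible (2 powr (1 / s) * (b + c)) (x + y)"
proof -
  have bc: "0 < b" "0 < c" using assms by (auto simp: admissible_def)
  have "modular m N (2 powr (1 / s) * (b + c)) (x + y) \<le> 1" for m N
  proof -
    \<comment> \<open>Both bounds are moved to the common scale \<open>b + c\<close>, because
      \<open>modular_add\<close> needs one scale for both sequences; an average of two numbers at
      most 1 is at most 1.\<close>
    have "modular m N (b + c) x \<le> 1" "modular m N (b + c) y \<le> 1"
      using assms bc modular_antimono[of b "b + c" m N x] modular_antimono[of c "b + c" m N y]
      by (auto simp: admissible_def intro: order.trans)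
    with modular_add[of "b + c" m N x y] bc show ?thesis by simp
  qed
  then show ?thesis using bc by (simp add: admissible_def)
qed

section \<open>The extended-real norm in terms of admissible numbers\<close>

lemma local_norm_eq: "local_norm \<phi> \<Phi> m N x = Inf (ereal ` {b. b > 0 \<and> modular m N b x \<le> 1})"
  by (simp add: local_norm_def modular_def)

lemma norm_nonneg: "0 \<le> orlicz_morrey_norm \<phi> \<Phi> x"
proof -
  have "0 \<le> local_norm \<phi> \<Phi> 0 0 x"
    unfolding local_norm_eq by (intro Inf_greatest) auto
  also have "\<dots> \<le> orlicz_morrey_norm \<phi> \<Phi> x"
    unfolding orlicz_morrey_norm_def by (rule SUP_upper2[of "(0, 0)"]) auto
  finally show ?thesis .
qed

lemma norm_le: "admissible b x \<Longrightarrow> orlicz_morrey_norm \<phi> \<Phi> x \<le> ereal b"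
  unfolding orlicz_morrey_norm_def
  by (intro SUP_least) (auto simp: local_norm_eq admissible_def intro!: Inf_lower)

text \<open>The strict bound yields on each window some \<open>b < c\<close> satisfying the modular
  inequality. This \<open>b\<close> depends on the window, and monotonicity raises it to the common
  value \<open>c\<close>.\<close>

lemma norm_less_admissible:
  assumes "orlicz_morrey_norm \<phi> \<Phi> x < ereal c"
  shows "admissible c x"
proof -
  have "0 < c" using assms norm_nonneg[of x] by (metis ereal_less(2) order.strict_trans1)
  moreover have "modular m N c x \<le> 1" for m N
  proof -
    have "local_norm \<phi> \<Phi> m N x \<le> orlicz_morrey_norm \<phi> \<Phi> x"
      unfolding orlicz_morrey_norm_def by (rule SUP_upper2[of "(m, N)"]) auto
    with assms have "local_norm \<phi> \<Phi> m N x < ereal c" by simp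
    then obtain b where "0 < b" "modular m N b x \<le> 1" "b < c"
      by (auto simp: local_norm_eq Inf_less_iff)
    then show ?thesis using modular_antimono[of b c m N x] by simp
  qed
  ultimately show ?thesis by (simp add: admissible_def)
qed

lemma mem_space_iff: "x \<in> space \<longleftrightarrow> (\<exists>b. admissible b x)"
proof
  assume "x \<in> space"
  then have "orlicz_morrey_norm \<phi> \<Phi> x < \<infinity>" by (simp add: orlicz_morrey_space_def)
  then obtain b where "orlicz_morrey_norm \<phi> \<Phi> x < ereal b"
    using less_PInf_Ex_of_nat by auto
  then show "\<exists>b. admissible b x" using norm_less_admissible by blast
next
  assume "\<exists>b. admissible b x"
  then obtain b where "orlicz_morrey_norm \<phi> \<Phi> x \<le> ereal b" using norm_le by blast
  also have "\<dots> < \<infinity>" by simp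
  finally show "x \<in> space" by (simp add: orlicz_morrey_space_def)
qed

lemma qnorm_nonneg: "0 \<le> qnorm x"
  using norm_nonneg by (simp add: real_of_ereal_pos)

text \<open>Membership matters: off the space the norm is infinite and \<open>real_of_ereal\<close>
  returns 0, so a small \<open>qnorm\<close> would say nothing.\<close>

lemma qnorm_less_admissible:
  assumes "x \<in> space" "qnorm x < c"
  shows "admissible c x"
proof (rule norm_less_admissible)
  have "orlicz_morrey_norm \<phi> \<Phi> x = ereal (qnorm x)"
    using assms(1) norm_nonneg[of x] by (auto simp: orlicz_morrey_space_def ereal_real)
  then show "orlicz_morrey_norm \<phi> \<Phi> x < ereal c"
    using assms(2) by (metis less_ereal.simps(1))
qed

lemma qnorm_le: "admissible b x \<Longrightarrow> qnorm x \<le> b"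
  using norm_le[of b x] norm_nonneg[of x]
  by (cases "orlicz_morrey_norm \<phi> \<Phi> x") auto

lemma qnorm_0: "qnorm 0 = 0"
proof (rule order.antisym)
  show "qnorm 0 \<le> 0"
  proof (rule field_le_epsilon)
    show "qnorm 0 \<le> 0 + e" if "0 < e" for e
      using qnorm_le[OF admissible_0[OF that]] by simp
  qed
qed (rule qnorm_nonneg)

section \<open>Linear structure and quasi-norm axioms\<close>

lemma space_add: "\<lbrakk>x \<in> space; y \<in> space\<rbrakk> \<Longrightarrow> x + y \<in> space"
  unfolding mem_space_iff using admissible_add by blast

lemma space_scale:
  assumes "x \<in> space"
  shows "(\<lambda>k. a * x k) \<in> space"
proof (cases "a = 0")
  case True
  then show ?thesis using admissible_0[of 1] by (auto simp: mem_space_iff zero_fun_def)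
next
  case False
  then show ?thesis using assms admissible_scale unfolding mem_space_iff by blast
qed

lemma space_diff: "\<lbrakk>x \<in> space; y \<in> space\<rbrakk> \<Longrightarrow> x - y \<in> space"
  using space_add[of x "\<lambda>k. - 1 * y k"] space_scale[of y "- 1"]
  by (simp add: plus_fun_def fun_diff_def)

text \<open>On the window \<open>{k}\<close> the modular inequality reads
  \<open>\<phi> 1 * \<Phi> (\<bar>x k\<bar> / c) \<le> 1\<close>. A \<open>T\<close> with
  \<open>\<Phi> T > 1 / \<phi> 1\<close> therefore bounds \<open>\<bar>x k\<bar> / c\<close>,
  uniformly in \<open>x\<close> and \<open>k\<close>. This serves both definiteness and
  completeness.\<close>

lemma coordinate_bound:
  obtains T where "0 < T" "\<And>x k. x \<in> space \<Longrightarrow> \<bar>x k\<bar> \<le> T * qnorm x"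
proof -
  have "eventually (\<lambda>t. \<Phi> t > 1 / \<phi> 1 \<and> t > 0) at_top"
    using Phi_at_top by (intro eventually_conj eventually_gt_at_top) (auto simp: filterlim_at_top_dense)
  then obtain T where T: "0 < T" "\<Phi> T > 1 / \<phi> 1"
    using eventually_happens by fastforce
  have "\<bar>x k\<bar> \<le> T * qnorm x" if "x \<in> space" for x k
  proof -
    have "\<bar>x k\<bar> / T \<le> c" if "qnorm x < c" for c
    proof (rule ccontr)
      assume large: "\<not> \<bar>x k\<bar> / T \<le> c"
      have "admissible c x" using \<open>x \<in> space\<close> that by (rule qnorm_less_admissible)
      then have c: "0 < c" and "modular k 0 c x \<le> 1" by (auto simp: admissible_def)
      then have "\<phi> 1 * \<Phi> (\<bar>x k\<bar> / c) \<le> 1" by (simp add: modular_def window_def)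
      then have "\<Phi> (\<bar>x k\<bar> / c) \<le> 1 / \<phi> 1" using phi_pos[of 0] by (simp add: field_simps)
      moreover have "\<Phi> T \<le> \<Phi> (\<bar>x k\<bar> / c)"
        using large T c by (intro Phi_mono) (auto simp: field_simps)
      ultimately show False using T by simp
    qed
    then have "\<bar>x k\<bar> / T \<le> qnorm x" by (rule dense_ge)
    then show ?thesis using T by (simp add: field_simps)
  qed
  with T show ?thesis using that by blast
qed

lemma qnorm_eq_0_iff:
  assumes "x \<in> space"
  shows "qnorm x = 0 \<longleftrightarrow> x = 0"
proof
  assume "qnorm x = 0"
  moreover obtain T where "\<And>x k. x \<in> space \<Longrightarrow> \<bar>x k\<bar> \<le> T * qnorm x"
    using coordinate_bound by metis
  ultimately have "\<bar>x k\<bar> \<le> 0" for k using assms by (metis mult_zero_right)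
  then show "x = 0" by (simp add: fun_eq_iff)
qed (simp add: qnorm_0)

lemma qnorm_scale_le:
  assumes "x \<in> space" "a \<noteq> 0"
  shows "qnorm (\<lambda>k. a * x k) \<le> \<bar>a\<bar> * qnorm x"
proof -
  have "qnorm (\<lambda>k. a * x k) / \<bar>a\<bar> \<le> c" if "qnorm x < c" for c
    using qnorm_le[OF admissible_scale[OF assms(2) qnorm_less_admissible[OF assms(1) that]]] assms(2)
    by (simp add: field_simps)
  then have "qnorm (\<lambda>k. a * x k) / \<bar>a\<bar> \<le> qnorm x" by (rule dense_ge)
  then show ?thesis using assms(2) by (simp add: field_simps)
qed

lemma qnorm_scale:
  assumes "x \<in> space"
  shows "qnorm (\<lambda>k. a * x k) = \<bar>a\<bar> * qnorm x"
proof (cases "a = 0")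
  case True
  then show ?thesis using qnorm_0 by (simp add: zero_fun_def)
next
  case False
  \<comment> \<open>The reverse inequality is the same estimate applied to the scaled sequence and
    the inverse scalar.\<close>
  have "qnorm (\<lambda>k. 1 / a * (a * x k)) \<le> \<bar>1 / a\<bar> * qnorm (\<lambda>k. a * x k)"
    using False space_scale[OF assms] by (intro qnorm_scale_le) auto
  then have "\<bar>a\<bar> * qnorm x \<le> qnorm (\<lambda>k. a * x k)"
    using False by (simp add: field_simps)
  then show ?thesis using qnorm_scale_le[OF assms False] by simp
qed

lemma qnorm_add_le:
  assumes "x \<in> space" "y \<in> space"
  shows "qnorm (x + y) \<le> 2 powr (1 / s) * (qnorm x + qnorm y)"
proof -
  have "qnorm (x + y) / 2 powr (1 / s) \<le> (qnorm x + qnorm y) + e" if "0 < e" for e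
  proof -
    \<comment> \<open>The slack \<open>e / 2\<close> is there because only numbers strictly above
      \<open>qnorm\<close> are known to be admissible.\<close>
    have "admissible (2 powr (1 / s) * ((qnorm x + e / 2) + (qnorm y + e / 2))) (x + y)"
      using assms that by (intro admissible_add qnorm_less_admissible) auto
    from qnorm_le[OF this] show ?thesis by (simp add: field_simps)
  qed
  then have "qnorm (x + y) / 2 powr (1 / s) \<le> qnorm x + qnorm y" by (rule field_le_epsilon)
  then show ?thesis by (simp add: field_simps)
qed

section \<open>Coordinatewise limits and completeness\<close>

lemma admissible_limit:
  assumes "\<And>k. (\<lambda>n. v n k) \<longlonglongrightarrow> x k"
    and "eventually (\<lambda>n. admissible b (v n)) sequentially"
  shows "admissible b x"
proof -
  \<comment> \<open>Positivity of \<open>b\<close> has to be read off from some term of the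
    sequence.\<close>
  have "\<exists>n. admissible b (v n)" using assms(2) eventually_happens'[of sequentially] by auto
  then have b: "0 < b" by (auto simp: admissible_def)
  have "modular m N b x \<le> 1" for m N
  proof (rule tendsto_upperbound)
    have "(\<lambda>n. \<Phi> (\<bar>v n k\<bar> / b)) \<longlonglongrightarrow> \<Phi> (\<bar>x k\<bar> / b)" for k
      using b by (intro continuous_on_tendsto_compose[OF Phi_continuous] tendsto_intros assms(1)) auto
    then show "(\<lambda>n. modular m N b (v n)) \<longlonglongrightarrow> modular m N b x"
      unfolding modular_def by (intro tendsto_mult tendsto_const tendsto_sum)
    show "eventually (\<lambda>n. modular m N b (v n) \<le> 1) sequentially"
      using assms(2) by eventually_elim (simp add: admissible_def)
  qed simp
  with b show ?thesis by (simp add: admissible_def)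
qed

lemma complete:
  assumes u: "\<And>n. u n \<in> space"
    and cauchy: "\<And>e. e > 0 \<Longrightarrow> \<exists>M. \<forall>n\<ge>M. \<forall>m\<ge>M. qnorm (u n - u m) < e"
  shows "\<exists>x\<in>space. (\<lambda>n::nat. qnorm (u n - x)) \<longlonglongrightarrow> 0"
proof -
  obtain T where T: "0 < T" "\<And>x k. x \<in> space \<Longrightarrow> \<bar>x k\<bar> \<le> T * qnorm x"
    using coordinate_bound by metis
  have "Cauchy (\<lambda>n. u n k)" for k
  proof (rule CauchyI)
    fix e :: real assume "e > 0"
    then obtain M where M: "\<And>n m. \<lbrakk>n \<ge> M; m \<ge> M\<rbrakk> \<Longrightarrow> qnorm (u n - u m) < e / T"
      using cauchy[of "e / T"] T(1) by (meson divide_pos_pos)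
    have "\<bar>u m k - u n k\<bar> < e" if "m \<ge> M" "n \<ge> M" for m n
    proof -
      have "\<bar>(u m - u n) k\<bar> \<le> T * qnorm (u m - u n)" by (intro T(2) space_diff u)
      also have "\<dots> < T * (e / T)" using M[OF that] T(1) by (intro mult_strict_left_mono)
      finally show ?thesis using T(1) by simp
    qed
    then show "\<exists>M. \<forall>m\<ge>M. \<forall>n\<ge>M. norm (u m k - u n k) < e" by auto
  qed
  then have "\<exists>l. (\<lambda>n. u n k) \<longlonglongrightarrow> l" for k by (simp add: Cauchy_convergent_iff convergent_def)
  then obtain x where x: "\<And>k. (\<lambda>n. u n k) \<longlonglongrightarrow> x k" by metis
  \<comment> \<open>With \<open>n\<close> fixed, \<open>m\<close> tends to infinity in
    \<open>u n - u m\<close>: the Cauchy bound makes \<open>e\<close> admissible for these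
    differences, hence for their limit \<open>u n - x\<close>.\<close>
  have tail: "\<exists>M. \<forall>n\<ge>M. admissible e (u n - x)" if e: "e > 0" for e
  proof -
    obtain M where M: "\<And>n m. \<lbrakk>n \<ge> M; m \<ge> M\<rbrakk> \<Longrightarrow> qnorm (u n - u m) < e"
      using cauchy[OF e] by blast
    have "admissible e (u n - x)" if "n \<ge> M" for n
    proof (rule admissible_limit)
      show "(\<lambda>m. (u n - u m) k) \<longlonglongrightarrow> (u n - x) k" for k
        using x by (simp add: tendsto_diff)
      show "eventually (\<lambda>m. admissible e (u n - u m)) sequentially"
        using eventually_ge_at_top[of M]
        by eventually_elim (intro qnorm_less_admissible space_diff u M that)
    qed
    then show ?thesis by blast
  qed
  obtain M where "admissible 1 (u M - x)" using tail[of 1] by auto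
  then have "u M - x \<in> space" unfolding mem_space_iff by blast
  \<comment> \<open>Here \<open>x\<close> is recovered as \<open>u M - (u M - x)\<close>.\<close>
  from space_diff[OF u[of M] this] have "x \<in> space" by simp
  moreover have "(\<lambda>n. qnorm (u n - x)) \<longlonglongrightarrow> 0"
  proof (rule LIMSEQ_I)
    fix e :: real assume "e > 0"
    \<comment> \<open>Halving \<open>e\<close> makes up for \<open>qnorm_le\<close> giving only a
      weak inequality.\<close>
    then obtain M where M: "\<And>n. n \<ge> M \<Longrightarrow> admissible (e / 2) (u n - x)"
      using tail[of "e / 2"] by auto
    have "norm (qnorm (u n - x) - 0) < e" if "n \<ge> M" for n
      using qnorm_le[OF M[OF that]] qnorm_nonneg[of "u n - x"] \<open>e > 0\<close> by (simp del: abs_real_of_ereal)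
    then show "\<exists>M. \<forall>n\<ge>M. norm (qnorm (u n - x) - 0) < e" by blast
  qed
  ultimately show ?thesis by blast
qed

end

section \<open>The ambient vector space and the conclusion\<close>

lemma vector_space_pointwise: "vector_space (\<lambda>(a::real) x k. a * x k :: real)"
  by unfold_locales (auto simp: fun_eq_iff algebra_simps)

theorem theorem3p8:
  fixes s :: real and \<Phi> :: "real \<Rightarrow> real" and \<phi> :: "nat \<Rightarrow> real"
  assumes "0 < s" and "s \<le> 1"
    and "s_young s \<Phi>"
    and "\<phi> \<in> G_phi"
  shows "quasi_banach_space (\<lambda>a x k. a * x k) (orlicz_morrey_space \<phi> \<Phi>)
           (\<lambda>x. real_of_ereal (orlicz_morrey_norm \<phi> \<Phi> x))"
proof -
  interpret orlicz_morrey s \<Phi> \<phi> using assms by unfold_locales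
  interpret V: vector_space "\<lambda>a (x :: int \<Rightarrow> real) k. a * x k"
    by (rule vector_space_pointwise)
  have sub: "V.subspace space"
    using admissible_0[of 1]
    by (auto simp: V.subspace_def space_add space_scale mem_space_iff[of 0])
  have "1 \<le> 2 powr (1 / s)" using assms(1) by (simp add: ge_one_powr_ge_zero)
  then have "\<exists>C\<ge>1. \<forall>x\<in>space. \<forall>y\<in>space. qnorm (x + y) \<le> C * (qnorm x + qnorm y)"
    using qnorm_add_le by blast
  with sub show ?thesis
    by unfold_locales (simp_all add: qnorm_nonneg qnorm_eq_0_iff qnorm_scale complete del: minus_apply)
qed

end
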